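(* Let $X$ be a Banach space of infratype $p>1$ with constant $I_p(X)$. Then, for every $n,r\in\mathbb N$, $$\operatorname{Radon}_X(2n,r)\le I_p(X)\,(nr)^{-1+\frac1p}.$$
   Context: A Banach space $X$ has infratype $p\in[1,2]$ if there is a constant $I<\infty$ such that for every finite sequence $x_1,\dots,x_m\in X$, $\min_{\theta_i=\pm1}\|\sum_{i=1}^m\theta_i x_i\|\le I\left(\sum_{i=1}^m\|x_i\|^p\right)^{1/p}$; $I_p(X)$ is the least such constant. For pairwise disjoint sets $Z_1,\dots,Z_r\subset X$, each of cardinality $2n$, put $S=\bigcup_{j=1}^r Z_j$ and $D=\max_j\operatorname{diam}Z_j$. A balanced Radon split is a partition $S=Q_0\sqcup Q_1$ with $|Q_0\cap Z_j|=|Q_1\cap Z_j|=n$ for all $j$. Then $\operatorname{Radon}_X(2n,r)=\sup_{Z_1,\dots,Z_r}\inf_{S=Q_0\sqcup Q_1}\frac{\operatorname{dist}(\operatorname{conv}Q_0,\operatorname{conv}Q_1)}{D}$, the infimum over all balanced Radon splits, where $\operatorname{dist}(A,B)=\inf\{\|a-b\|:a\in A,b\in B\}$. *)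

theory Defs
  imports "HOL-Analysis.Analysis"
begin

text \<open>The space \<open>X\<close> is passed as a type token. Constants are required to be nonnegative so that
  the least one also exists for the zero space.\<close>

definition infratype_bound :: "'a::real_normed_vector itself \<Rightarrow> real \<Rightarrow> real \<Rightarrow> bool" where
  "infratype_bound X p I \<longleftrightarrow>
     0 \<le> I \<and>
     (\<forall>(m::nat) (x :: nat \<Rightarrow> 'a).
        Min ((\<lambda>\<theta>. norm (\<Sum>i<m. \<theta> i *\<^sub>R x i)) ` ({..<m} \<rightarrow>\<^sub>E {- 1, 1 :: real}))
          \<le> I * (\<Sum>i<m. norm (x i) powr p) powr (1 / p))"

definition has_infratype :: "'a::real_normed_vector itself \<Rightarrow> real \<Rightarrow> bool" where
  "has_infratype X p \<longleftrightarrow> p \<in> {1..2} \<and> (\<exists>I. infratype_bound X p I)"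

definition infratype_const :: "'a::real_normed_vector itself \<Rightarrow> real \<Rightarrow> real" where
  "infratype_const X p = Inf {I. infratype_bound X p I}"

text \<open>The infimum in the previous definition is attained, i.e. it is the least constant.\<close>

lemma infratype_bound_infratype_const:
  fixes X :: "'a::real_normed_vector itself"
  assumes "has_infratype X p"
  shows "infratype_bound X p (infratype_const X p)"
proof -
  let ?S = "{I. infratype_bound X p I}"
  have ne: "?S \<noteq> {}"
    using assms by (auto simp: has_infratype_def)
  have bdd: "bdd_below ?S"
    by (rule bdd_belowI[of _ 0]) (auto simp: infratype_bound_def)
  have "?S = {0..} \<inter> (\<Inter>m. \<Inter>x :: nat \<Rightarrow> 'a. {I.
      Min ((\<lambda>\<theta>. norm (\<Sum>i<m. \<theta> i *\<^sub>R x i)) ` ({..<m} \<rightarrow>\<^sub>E {- 1, 1 :: real}))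
        \<le> I * (\<Sum>i<m. norm (x i) powr p) powr (1 / p)})"
    by (auto simp: infratype_bound_def)
  moreover have "closed \<dots>"
    by (intro closed_Int closed_INT ballI closed_Collect_le continuous_intros closed_atLeast)
  ultimately have "closed ?S"
    by simp
  then show ?thesis
    using closed_contains_Inf[OF ne bdd] by (simp add: infratype_const_def)
qed

lemma infratype_const_le: "infratype_bound X p I \<Longrightarrow> infratype_const X p \<le> I"
  unfolding infratype_const_def
  by (rule cInf_lower) (auto intro: bdd_belowI[of _ 0] simp: infratype_bound_def)

text \<open>The indices \<open>j = 1, \<dots>, r\<close> are represented by \<open>j < r\<close>.\<close>

definition radon_families :: "nat \<Rightarrow> nat \<Rightarrow> (nat \<Rightarrow> 'a set) set" where
  "radon_families n r =
     {Z. disjoint_family_on Z {..<r} \<and> (\<forall>j<r. finite (Z j) \<and> card (Z j) = 2 * n)}"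

definition balanced_radon_splits :: "nat \<Rightarrow> nat \<Rightarrow> (nat \<Rightarrow> 'a set) \<Rightarrow> ('a set \<times> 'a set) set" where
  "balanced_radon_splits n r Z =
     {(Q0, Q1). Q0 \<union> Q1 = (\<Union>j<r. Z j) \<and> Q0 \<inter> Q1 = {} \<and>
        (\<forall>j<r. card (Q0 \<inter> Z j) = n \<and> card (Q1 \<inter> Z j) = n)}"

text \<open>\<open>radon X n r\<close> is \<open>Radon\<^sub>X(2n, r)\<close>, for \<open>n, r \<ge> 1\<close>. It takes values in \<^typ>\<open>ennreal\<close>, so that
  the supremum is meaningful (namely \<open>0\<close>) when \<open>X\<close> is the zero space and there are no families.\<close>

definition radon :: "'a::real_normed_vector itself \<Rightarrow> nat \<Rightarrow> nat \<Rightarrow> ennreal" where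
  "radon X n r =
     (SUP Z \<in> (radon_families n r :: (nat \<Rightarrow> 'a set) set).
        INF (Q0, Q1) \<in> balanced_radon_splits n r Z.
          ennreal (setdist (convex hull Q0) (convex hull Q1) /
                   Max ((\<lambda>j. diameter (Z j)) ` {..<r})))"

end

theory Submission imports Defs begin

text \<open>Pair up the points within each \<open>Z\<^sub>j\<close>. Infratype, applied to the \<open>nr\<close> differences of the pairs,
  yields signs for which the signed sum of the differences is small; the signs decide which point
  of each pair goes to \<open>Q\<^sub>0\<close>. The barycentres of the two halves then differ by that signed
  sum divided by \<open>nr\<close>.\<close>

text \<open>Passes from sequences indexed by \<open>{..<m}\<close> to families over an arbitrary
  finite set by enumerating it. The minimum in the definition runs over a finite nonempty set of
  sign patterns, so some pattern attains it.\<close>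

lemma infratype_bound_signs:
  fixes x :: "'b \<Rightarrow> 'a::real_normed_vector"
  assumes I: "infratype_bound TYPE('a) p I" and A: "finite A"
  obtains \<theta> :: "'b \<Rightarrow> real" where "\<And>y. y \<in> A \<Longrightarrow> \<theta> y \<in> {- 1, 1}"
    and "norm (\<Sum>y\<in>A. \<theta> y *\<^sub>R x y) \<le> I * (\<Sum>y\<in>A. norm (x y) powr p) powr (1 / p)"
proof -
  define m where "m = card A"
  obtain f where f: "bij_betw f {..<m} A"
    using ex_bij_betw_nat_finite[OF A] unfolding m_def atLeast0LessThan by blast
  \<comment> \<open>The inverse of the enumeration carries the signs from indices back to elements
    of \<open>A\<close>.\<close>
  define g where "g = the_inv_into {..<m} f"
  have g: "g (f i) = i" if "i < m" for i
    using f that by (simp add: g_def the_inv_into_f_f bij_betw_def)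
  have gA: "g y < m" if "y \<in> A" for y
    using bij_betwE[OF bij_betw_the_inv_into[OF f]] that by (auto simp: g_def)
  define N where "N = (\<lambda>\<theta> :: nat \<Rightarrow> real. norm (\<Sum>i<m. \<theta> i *\<^sub>R x (f i)))"
  define P where "P = ({..<m} \<rightarrow>\<^sub>E {- 1, 1 :: real})"
  have "finite P" "P \<noteq> {}"
    by (auto simp: P_def intro!: finite_PiE simp: PiE_eq_empty_iff)
  then have "Min (N ` P) \<in> N ` P"
    by (intro Min_in) auto
  then obtain \<theta> where \<theta>: "\<theta> \<in> P" "N \<theta> = Min (N ` P)"
    by auto
  have "N \<theta> \<le> I * (\<Sum>i<m. norm (x (f i)) powr p) powr (1 / p)"
    unfolding \<theta>(2) unfolding N_def P_def using I by (auto simp: infratype_bound_def)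
  moreover have "(\<Sum>i<m. norm (x (f i)) powr p) = (\<Sum>y\<in>A. norm (x y) powr p)"
    by (rule sum.reindex_bij_betw[OF f])
  moreover have "(\<Sum>i<m. \<theta> i *\<^sub>R x (f i)) = (\<Sum>y\<in>A. \<theta> (g y) *\<^sub>R x y)"
    by (subst sum.reindex_bij_betw[OF f, symmetric]) (simp add: g)
  ultimately show thesis
    using \<theta>(1) gA by (intro that[of "\<theta> \<circ> g"]) (auto simp: N_def P_def PiE_iff)
qed

lemma even_card_pairing:
  assumes "finite Z" "card Z = 2 * n"
  obtains A h where "A \<subseteq> Z" "card A = n" "bij_betw h A (Z - A)"
proof -
  obtain A where A: "A \<subseteq> Z" "card A = n"
    using obtain_subset_with_card_n[of n Z] assms by auto
  have "finite A"
    using A(1) assms(1) finite_subset by blast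
  moreover have "card A = card (Z - A)"
    using A assms(2) \<open>finite A\<close> by (simp add: card_Diff_subset)
  ultimately obtain h where "bij_betw h A (Z - A)"
    using finite_same_card_bij[of A "Z - A"] assms(1) by auto
  with A that show thesis by blast
qed

text \<open>Exactly one point is taken from each pair \<open>y\<close>, \<open>h y\<close>: the
  first if \<open>P y\<close>, the second otherwise. Injectivity of \<open>h\<close> and
  disjointness of \<open>A\<close> and \<open>B\<close> keep these choices distinct.\<close>

lemma card_pairing_selection:
  assumes "finite A" "bij_betw h A B" "A \<inter> B = {}"
  shows "card ({y \<in> A. P y} \<union> h ` {y \<in> A. \<not> P y}) = card A"
proof -
  have "inj_on h {y \<in> A. \<not> P y}"
    using assms(2) by (auto simp: bij_betw_def inj_on_def)
  moreover have "{y \<in> A. P y} \<inter> h ` {y \<in> A. \<not> P y} = {}"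
    using assms(2,3) by (auto simp: bij_betw_def)
  ultimately have "card ({y \<in> A. P y} \<union> h ` {y \<in> A. \<not> P y})
      = card {y \<in> A. P y} + card {y \<in> A. \<not> P y}"
    using assms(1) by (simp add: card_Un_disjoint card_image)
  also have "\<dots> = card ({y \<in> A. P y} \<union> {y \<in> A. \<not> P y})"
    using assms(1) by (intro card_Un_disjoint[symmetric]) auto
  also have "{y \<in> A. P y} \<union> {y \<in> A. \<not> P y} = A"
    by auto
  finally show ?thesis .
qed

lemma average_in_convex_hull:
  fixes f :: "'b \<Rightarrow> 'a::real_vector"
  assumes "finite A" "A \<noteq> {}" "\<And>y. y \<in> A \<Longrightarrow> f y \<in> Q"
  shows "(1 / real (card A)) *\<^sub>R (\<Sum>y\<in>A. f y) \<in> convex hull Q"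
  unfolding scaleR_sum_right
  by (rule convex_sum) (use assms in \<open>auto intro: hull_inc\<close>)

text \<open>Since the blocks are disjoint, their separate pairings glue to a single map
  \<open>h\<close>, so that all pairs can be indexed by one set of points.\<close>

lemma radon_family_pairing:
  fixes Z :: "nat \<Rightarrow> 'a set"
  assumes "Z \<in> radon_families n r"
  obtains A h where "\<And>j. j < r \<Longrightarrow> A j \<subseteq> Z j" "\<And>j. j < r \<Longrightarrow> card (A j) = n"
    "\<And>j. j < r \<Longrightarrow> bij_betw h (A j) (Z j - A j)"
proof -
  have disj: "disjoint_family_on Z {..<r}"
    and Z: "\<And>j. j < r \<Longrightarrow> finite (Z j) \<and> card (Z j) = 2 * n"
    using assms by (auto simp: radon_families_def)
  have "\<forall>j. \<exists>A h. j < r \<longrightarrow> A \<subseteq> Z j \<and> card A = n \<and> bij_betw h A (Z j - A)"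
    using even_card_pairing Z by metis
  then obtain A k where *: "\<And>j. j < r \<Longrightarrow>
      A j \<subseteq> Z j \<and> card (A j) = n \<and> bij_betw (k j) (A j) (Z j - A j)"
    by metis
  \<comment> \<open>Look up the unique block containing \<open>y\<close>, then use the pairing of
    that block.\<close>
  define h where "h = (\<lambda>y. k (THE j. j < r \<and> y \<in> Z j) y)"
  have "h y = k j y" if "j < r" "y \<in> A j" for j y
  proof -
    have "(THE j. j < r \<and> y \<in> Z j) = j"
    proof (rule the_equality)
      show "j < r \<and> y \<in> Z j"
        using that * by blast
      then show "i = j" if "i < r \<and> y \<in> Z i" for i
        using that disjoint_family_onD[OF disj, of i j] by blast
    qed
    then show ?thesis by (simp add: h_def)
  qed
  then have "bij_betw h (A j) (Z j - A j)" if "j < r" for j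
    using * that by (subst bij_betw_cong[of _ _ "k j"]) auto
  with * that show thesis by blast
qed

text \<open>The bound is in product form, for any common bound \<open>D\<close> on the diameters;
  positivity of \<open>D\<close> matters only when dividing by it later.\<close>

lemma balanced_radon_split_exists:
  fixes Z :: "nat \<Rightarrow> 'a::real_normed_vector set"
  assumes I: "infratype_bound TYPE('a) p I" and p: "p > 1"
    and n: "n \<ge> 1" and r: "r \<ge> 1" and Z: "Z \<in> radon_families n r"
    and D: "\<And>j. j < r \<Longrightarrow> diameter (Z j) \<le> D"
  obtains Q0 Q1 where "(Q0, Q1) \<in> balanced_radon_splits n r Z"
    and "setdist (convex hull Q0) (convex hull Q1) \<le> I * real (n * r) powr (- 1 + 1 / p) * D"
proof -
  have disj: "Z i \<inter> Z j = {}" if "i < r" "j < r" "i \<noteq> j" for i j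
    using Z that by (auto simp: radon_families_def disjoint_family_on_def)
  have Zfin: "finite (Z j)" if "j < r" for j
    using Z that by (auto simp: radon_families_def)
  obtain A h where A: "\<And>j. j < r \<Longrightarrow> A j \<subseteq> Z j" "\<And>j. j < r \<Longrightarrow> card (A j) = n"
    and h: "\<And>j. j < r \<Longrightarrow> bij_betw h (A j) (Z j - A j)"
    using radon_family_pairing[OF Z] by metis
  \<comment> \<open>One representative of each of the \<open>n * r\<close> pairs; infratype is
    applied over this index set.\<close>
  define B where "B = (\<Union>j<r. A j)"
  have Afin: "finite (A j)" if "j < r" for j
    using A(1) Zfin that finite_subset by blast
  have Bfin: "finite B"
    using Afin by (auto simp: B_def)
  have "card B = (\<Sum>j<r. card (A j))"
    unfolding B_def by (rule card_UN_disjoint) (use Afin A(1) disj in blast)+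
  then have cardB: "card B = n * r"
    using A(2) by simp
  have Bne: "B \<noteq> {}"
    using cardB n r by auto
  have hZ: "h y \<in> Z j - A j" if "j < r" "y \<in> A j" for j y
    using h[OF that(1)] that(2) by (auto simp: bij_betw_def)
  have D0: "0 \<le> D"
    using D[of 0] r diameter_ge_0[OF finite_imp_bounded[OF Zfin[of 0]]] by linarith
  have diff: "norm (y - h y) \<le> D" if y: "y \<in> B" for y
  proof -
    obtain j where j: "j < r" "y \<in> A j"
      using y by (auto simp: B_def)
    have "dist y (h y) \<le> diameter (Z j)"
      using A(1)[OF j(1)] hZ[OF j] j
      by (intro diameter_bounded_bound[OF finite_imp_bounded[OF Zfin[OF j(1)]]]) blast+
    also have "\<dots> \<le> D"
      using D[OF j(1)] .
    finally show ?thesis by (simp add: dist_norm)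
  qed
  obtain \<theta> :: "'a \<Rightarrow> real" where \<theta>: "\<And>y. y \<in> B \<Longrightarrow> \<theta> y \<in> {- 1, 1}"
    and \<theta>_le: "norm (\<Sum>y\<in>B. \<theta> y *\<^sub>R (y - h y))
      \<le> I * (\<Sum>y\<in>B. norm (y - h y) powr p) powr (1 / p)"
    using infratype_bound_signs[OF I Bfin] by metis
  \<comment> \<open>Sign \<open>1\<close> sends \<open>y\<close> to \<open>Q0\<close> and
    \<open>h y\<close> to \<open>Q1\<close>; sign \<open>- 1\<close> does the opposite.\<close>
  define P where "P = (\<lambda>y. \<theta> y = 1)"
  define Q0 where "Q0 = {y \<in> B. P y} \<union> h ` {y \<in> B. \<not> P y}"
  define Q1 where "Q1 = {y \<in> B. \<not> P y} \<union> h ` {y \<in> B. P y}"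
  have inA: "y \<in> A j" if "y \<in> B" "y \<in> Z j" "j < r" for y j
  proof -
    obtain i where i: "i < r" "y \<in> A i"
      using \<open>y \<in> B\<close> by (auto simp: B_def)
    then have "i = j"
      using A(1)[OF i(1)] disj[of i j] that by blast
    with i show ?thesis by simp
  qed
  have inA': "y \<in> A j" if "y \<in> B" "h y \<in> Z j" "j < r" for y j
  proof -
    obtain i where i: "i < r" "y \<in> A i"
      using \<open>y \<in> B\<close> by (auto simp: B_def)
    then have "i = j"
      using hZ[OF i] disj[of i j] that by blast
    with i show ?thesis by simp
  qed
  \<comment> \<open>Both points of a pair lie in the same block, so intersecting with
    \<open>Z j\<close> retains exactly the pairs of that block. The predicate \<open>R\<close> is
    arbitrary to cover \<open>Q0\<close> (with \<open>P\<close>) and \<open>Q1\<close> (with its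
    negation) alike.\<close>
  have selZ: "({y \<in> B. R y} \<union> h ` {y \<in> B. \<not> R y}) \<inter> Z j
      = {y \<in> A j. R y} \<union> h ` {y \<in> A j. \<not> R y}" if j: "j < r" for R j
  proof -
    have "y \<in> B \<and> y \<in> Z j \<longleftrightarrow> y \<in> A j" "y \<in> B \<and> h y \<in> Z j \<longleftrightarrow> y \<in> A j" for y
      using j inA[of y j] inA'[of y j] A(1)[OF j] hZ[OF j, of y] unfolding B_def by blast+
    then show ?thesis by blast
  qed
  have card_sel: "card (({y \<in> B. R y} \<union> h ` {y \<in> B. \<not> R y}) \<inter> Z j) = n" if j: "j < r" for R j
    unfolding selZ[OF j] using card_pairing_selection[OF Afin[OF j] h[OF j], of R] A(2)[OF j] by auto
  have Q0Z: "Q0 \<inter> Z j = {y \<in> A j. P y} \<union> h ` {y \<in> A j. \<not> P y}"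
    and Q1Z: "Q1 \<inter> Z j = {y \<in> A j. \<not> P y} \<union> h ` {y \<in> A j. P y}" if "j < r" for j
    using selZ[OF that, of P] selZ[OF that, of "\<lambda>y. \<not> P y"] by (simp_all add: Q0_def Q1_def)
  have "B \<subseteq> (\<Union>j<r. Z j)" "h ` B \<subseteq> (\<Union>j<r. Z j)"
    using A(1) hZ unfolding B_def by blast+
  then have sub: "Q0 \<subseteq> (\<Union>j<r. Z j)" "Q1 \<subseteq> (\<Union>j<r. Z j)"
    unfolding Q0_def Q1_def by blast+
  have un: "(Q0 \<union> Q1) \<inter> Z j = Z j" if j: "j < r" for j
  proof -
    have "(Q0 \<union> Q1) \<inter> Z j = A j \<union> h ` A j"
      unfolding Int_Un_distrib2 Q0Z[OF j] Q1Z[OF j] by auto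
    then show ?thesis
      using h[OF j] A(1)[OF j] by (auto simp: bij_betw_def)
  qed
  have int: "Q0 \<inter> Q1 \<inter> Z j = {}" if j: "j < r" for j
  proof -
    have "Q0 \<inter> Q1 \<inter> Z j = (Q0 \<inter> Z j) \<inter> (Q1 \<inter> Z j)"
      by auto
    then show ?thesis
      unfolding Q0Z[OF j] Q1Z[OF j] using hZ[OF j] h[OF j]
      by (auto simp: bij_betw_def dest: inj_onD)
  qed
  have "card (Q0 \<inter> Z j) = n" "card (Q1 \<inter> Z j) = n" if "j < r" for j
    using card_sel[OF that, of P] card_sel[OF that, of "\<lambda>y. \<not> P y"]
    by (simp_all add: Q0_def Q1_def)
  moreover have "Q0 \<union> Q1 = (\<Union>j<r. Z j)"
    using sub un by blast
  moreover have "Q0 \<inter> Q1 = {}"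
    using sub int by blast
  ultimately have "(Q0, Q1) \<in> balanced_radon_splits n r Z"
    by (simp add: balanced_radon_splits_def)
  moreover have "setdist (convex hull Q0) (convex hull Q1)
      \<le> I * real (n * r) powr (- 1 + 1 / p) * D"
  proof -
    define m where "m = real (n * r)"
    have m: "m > 0"
      using n r by (simp add: m_def)
    \<comment> \<open>Each of the \<open>m\<close> differences has norm at most \<open>D\<close>, so
      their p-norm is at most \<open>m powr (1 / p) * D\<close>.\<close>
    have "(\<Sum>y\<in>B. norm (y - h y) powr p) \<le> (\<Sum>y\<in>B. D powr p)"
      using p diff by (intro sum_mono powr_mono2) auto
    also have "\<dots> = m * D powr p"
      by (simp add: cardB m_def)
    finally have "(\<Sum>y\<in>B. norm (y - h y) powr p) powr (1 / p) \<le> (m * D powr p) powr (1 / p)"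
      using p by (intro powr_mono2 sum_nonneg) auto
    also have "\<dots> = m powr (1 / p) * D"
      using m D0 p by (simp add: powr_mult powr_powr)
    finally have sum_le: "I * (\<Sum>y\<in>B. norm (y - h y) powr p) powr (1 / p)
        \<le> I * (m powr (1 / p) * D)"
      using I by (intro mult_left_mono) (auto simp: infratype_bound_def)
    \<comment> \<open>\<open>a\<close> and \<open>b\<close> are the barycentres of \<open>Q0\<close>
      and \<open>Q1\<close>, both summed over pairs so that they can be subtracted termwise.\<close>
    define a where "a = (1 / m) *\<^sub>R (\<Sum>y\<in>B. if P y then y else h y)"
    define b where "b = (1 / m) *\<^sub>R (\<Sum>y\<in>B. if P y then h y else y)"
    have sel: "(if P y then y else h y) - (if P y then h y else y) = \<theta> y *\<^sub>R (y - h y)"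
      if "y \<in> B" for y
      using \<theta>[OF that] by (auto simp: P_def)
    have "a \<in> convex hull Q0" "b \<in> convex hull Q1"
      unfolding a_def b_def m_def cardB[symmetric]
      by (rule average_in_convex_hull[OF Bfin Bne]; auto simp: Q0_def Q1_def)+
    then have "setdist (convex hull Q0) (convex hull Q1) \<le> norm (a - b)"
      using setdist_le_dist by (metis dist_norm)
    also have "a - b = (1 / m) *\<^sub>R (\<Sum>y\<in>B. \<theta> y *\<^sub>R (y - h y))"
      unfolding a_def b_def scaleR_diff_right[symmetric] sum_subtractf[symmetric]
      using sel by simp
    also have "norm \<dots> = (1 / m) * norm (\<Sum>y\<in>B. \<theta> y *\<^sub>R (y - h y))"
      using m by simp
    also have "\<dots> \<le> (1 / m) * (I * (m powr (1 / p) * D))"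
      using \<theta>_le sum_le m by (intro mult_left_mono) auto
    \<comment> \<open>The averaging factor \<open>1 / m\<close> contributes the exponent -1, the
      infratype estimate the exponent 1/p.\<close>
    also have "\<dots> = I * (m powr (- 1) * m powr (1 / p)) * D"
      using m by (simp add: powr_minus_divide)
    also have "m powr (- 1) * m powr (1 / p) = m powr (- 1 + 1 / p)"
      by (rule powr_add[symmetric])
    finally show ?thesis
      by (simp add: m_def)
  qed
  ultimately show thesis
    by (rule that)
qed

theorem theorem1p4:
  fixes p :: real and n r :: nat
  assumes "has_infratype TYPE('a::banach) p" and "p > 1"
    and "n \<ge> 1" and "r \<ge> 1"
  shows "radon TYPE('a) n r
    \<le> ennreal (infratype_const TYPE('a) p * real (n * r) powr (- 1 + 1 / p))"
  unfolding radon_def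
proof (rule SUP_least)
  fix Z :: "nat \<Rightarrow> 'a set"
  assume Z: "Z \<in> radon_families n r"
  define D where "D = Max ((\<lambda>j. diameter (Z j)) ` {..<r})"
  have D: "diameter (Z j) \<le> D" if "j < r" for j
    unfolding D_def using that by (intro Max_ge) auto
  obtain Q0 Q1 where Q: "(Q0, Q1) \<in> balanced_radon_splits n r Z"
    and le: "setdist (convex hull Q0) (convex hull Q1)
      \<le> infratype_const TYPE('a) p * real (n * r) powr (- 1 + 1 / p) * D"
    using balanced_radon_split_exists[OF infratype_bound_infratype_const[OF assms(1)]
        assms(2-4) Z D] by metis
  \<comment> \<open>As r \<ge> 1, \<open>Z 0\<close> is a genuine block, and it has at least two
    points because n \<ge> 1. Hence \<open>D\<close> is positive and may be divided by.\<close>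
  have "finite (Z 0)" "card (Z 0) = 2 * n"
    using Z assms(4) by (auto simp: radon_families_def)
  then obtain u v where "u \<in> Z 0" "v \<in> Z 0" "u \<noteq> v"
    using card_le_Suc0_iff_eq[of "Z 0"] assms(3) by fastforce
  then have "0 < D"
    using diameter_bounded_bound[OF finite_imp_bounded[OF \<open>finite (Z 0)\<close>], of u v] D[of 0] assms(4)
    by (smt (verit) zero_less_dist_iff less_le_trans zero_less_one)
  then have "setdist (convex hull Q0) (convex hull Q1) / D
      \<le> infratype_const TYPE('a) p * real (n * r) powr (- 1 + 1 / p)"
    using le by (simp add: divide_le_eq)
  then show "(INF (Q0, Q1) \<in> balanced_radon_splits n r Z.
          ennreal (setdist (convex hull Q0) (convex hull Q1) /
                   Max ((\<lambda>j. diameter (Z j)) ` {..<r})))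
      \<le> ennreal (infratype_const TYPE('a) p * real (n * r) powr (- 1 + 1 / p))"
    by (intro INF_lower2[OF Q]) (simp add: D_def[symmetric] ennreal_leI)
qed

end
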